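(* Let $n$ and $k$ be positive integers, let $\alpha_1,\ldots,\alpha_n$ be positive real numbers, and let $b_1,\ldots,b_n$ be integers. Let $A_1,\ldots,A_n$ be finite subsets of $\mathbb{Z}$ each of cardinality $k$. For $1\leqslant i<j\leqslant n$ let $m_{ij}$ be an integer greater than $2\max\{|x_i-x_j|:\ x_i\in A_i,\ x_j\in A_j\}$. Then the set $$\Big\{\sum_{i=1}^n a_i:\ a_i\in A_i \text{ for all } i,\ a_i\alpha_i\neq a_j\alpha_j\ \text{and}\ a_i+b_i\not\equiv a_j+b_j \pmod{m_{ij}}\ \text{whenever}\ i<j\Big\}$$ has more than $(k-n)n$ elements. *)

theory Defs
  imports "HOL-Number_Theory.Number_Theory"
begin

end

theory Submission
  imports Defs "Jordan_Normal_Form.Determinant"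
begin

text \<open>
  Since \<open>m i j\<close> exceeds twice every difference, the congruence excludes at most one value
  \<open>c\<^sub>i\<^sub>j\<close> of \<open>a j - a i\<close>, so the restrictions express that
  \<open>\<Prod>\<^sub>i\<^sub><\<^sub>j (\<alpha>\<^sub>j x\<^sub>j - \<alpha>\<^sub>i x\<^sub>i) (x\<^sub>j - x\<^sub>i - c\<^sub>i\<^sub>j)\<close> does not vanish at \<open>a\<close>. If there were at most
  \<open>N = (k - n) n\<close> restricted sums \<open>s\<close>, then multiplying by factors \<open>x\<^sub>1 + \<dots> + x\<^sub>n - s\<close> would give a
  polynomial of degree \<open>n (k - 1)\<close> vanishing on the whole grid \<open>A\<^sub>1 \<times> \<dots> \<times> A\<^sub>n\<close>. By Lagrange
  interpolation its coefficient at \<open>\<Prod>\<^sub>i x\<^sub>i\<^bsup>k-1\<^esup>\<close> is then zero. But this coefficient depends only on the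
  top degree part \<open>\<Prod>\<^sub>i\<^sub><\<^sub>j (\<alpha>\<^sub>j x\<^sub>j - \<alpha>\<^sub>i x\<^sub>i) \<cdot> \<Prod>\<^sub>i\<^sub><\<^sub>j (x\<^sub>j - x\<^sub>i) \<cdot> (x\<^sub>1 + \<dots> + x\<^sub>n)\<^bsup>N\<^esup>\<close>. Expanding the
  first Vandermonde product over permutations \<open>\<tau>\<close>, the coefficient contributed by \<open>\<tau>\<close> has the
  sign of \<open>\<tau>\<close>, which cancels the sign in the expansion: what remains is a nonzero multiple of the
  permanent \<open>\<Sum>\<^sub>\<tau> \<Prod>\<^sub>i \<alpha>\<^sub>i\<^bsup>\<tau> i\<^esup>\<close>, which is positive.
\<close>

section \<open>Vandermonde determinants\<close>

definition vandermonde :: "nat \<Rightarrow> (nat \<Rightarrow> 'a::comm_ring_1) \<Rightarrow> 'a" where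
  "vandermonde n x = (\<Prod>j<n. \<Prod>i<j. x j - x i)"

lemma vandermonde_eq_0_iff:
  fixes x :: "nat \<Rightarrow> 'a::idom"
  shows "vandermonde n x = 0 \<longleftrightarrow> (\<exists>j<n. \<exists>i<j. x j = x i)"
  by (auto simp: vandermonde_def)

lemma det_mat_sum_permutations:
  "det (mat n n (\<lambda>(i, j). f i j)) = (\<Sum>\<sigma> | \<sigma> permutes {..<n}. of_int (sign \<sigma>) * (\<Prod>i<n. f i (\<sigma> i)))"
proof -
  have "mat n n (\<lambda>(i, j). f i j) $$ (i, \<sigma> i) = f i (\<sigma> i)" if "\<sigma> permutes {..<n}" "i < n" for \<sigma> i
    using that permutes_in_image[of \<sigma> "{..<n}" i] by simp
  then show ?thesis
    by (subst det_def'[of _ n]) (auto simp: atLeast0LessThan intro!: sum.cong prod.cong)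
qed

lemma mat_poly_eq_mult_mat_coeff:
  fixes x :: "nat \<Rightarrow> 'a::comm_semiring_1"
  assumes "\<And>j. j < n \<Longrightarrow> degree (p j) < n"
  shows "mat n n (\<lambda>(i, j). poly (p j) (x i)) =
           mat n n (\<lambda>(i, j). x i ^ j) * mat n n (\<lambda>(i, j). coeff (p j) i)" (is "_ = ?V * ?C")
proof (rule eq_matI)
  fix i j assume "i < dim_row (?V * ?C)" "j < dim_col (?V * ?C)"
  then have ij: "i < n" "j < n" by simp_all
  have "poly (p j) (x i) = (\<Sum>l\<le>degree (p j). coeff (p j) l * x i ^ l)"
    by (rule poly_altdef)
  also have "\<dots> = (\<Sum>l<n. coeff (p j) l * x i ^ l)"
    using assms[OF ij(2)] by (intro sum.mono_neutral_left) (auto intro!: le_degree)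
  finally show "mat n n (\<lambda>(i, j). poly (p j) (x i)) $$ (i, j) = (?V * ?C) $$ (i, j)"
    using ij by (simp add: scalar_prod_def mult.commute atLeast0LessThan)
qed simp_all

lemma det_mat_monic_poly:
  fixes x :: "nat \<Rightarrow> 'a::idom"
  assumes degree: "\<And>j. j < n \<Longrightarrow> degree (p j) = j"
    and monic: "\<And>j. j < n \<Longrightarrow> lead_coeff (p j) = 1"
  shows "det (mat n n (\<lambda>(i, j). poly (p j) (x i))) = det (mat n n (\<lambda>(i, j). x i ^ j))"
proof -
  define C where "C = mat n n (\<lambda>(i, j). coeff (p j) i)"
  have C: "C \<in> carrier_mat n n"
    by (simp add: C_def)
  have "upper_triangular C"
    using degree by (auto simp: upper_triangular_def C_def intro!: coeff_eq_0)
  moreover have "diag_mat C = map (\<lambda>_. 1) [0..<n]"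
    using degree monic by (auto simp: diag_mat_def C_def)
  ultimately have "det C = 1"
    using det_upper_triangular[OF _ C] by (simp add: map_replicate_const)
  moreover have "mat n n (\<lambda>(i, j). poly (p j) (x i)) = mat n n (\<lambda>(i, j). x i ^ j) * C"
    unfolding C_def by (rule mat_poly_eq_mult_mat_coeff) (simp add: degree)
  ultimately show ?thesis
    using C by (simp add: det_mult[of _ n])
qed

lemma det_mat_power_eq_vandermonde:
  fixes x :: "nat \<Rightarrow> 'a::idom"
  shows "det (mat n n (\<lambda>(i, j). x i ^ j)) = vandermonde n x"
proof (induction n)
  case 0
  show ?case by (simp add: vandermonde_def)
next
  case (Suc n)
  \<comment> \<open>Replacing the last column by the values of \<open>\<Prod>\<^sub>l\<^sub><\<^sub>n (X - x\<^sub>l)\<close> leaves its last entry as the only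
    nonzero one.\<close>
  define p where "p j = (if j < n then monom 1 j else (\<Prod>l<n. [:- x l, 1:]))" for j
  define M where "M = mat (Suc n) (Suc n) (\<lambda>(i, j). poly (p j) (x i))"
  have last_column: "M $$ (i, n) = (\<Prod>l<n. x i - x l)" if "i \<le> n" for i
    using that by (simp add: M_def p_def poly_prod)
  have last_column_eq_0: "M $$ (i, n) = 0" if "i < n" for i
    using that by (subst last_column) auto
  have minor: "mat_delete M n n = mat n n (\<lambda>(i, j). x i ^ j)"
    by (rule eq_matI) (auto simp: mat_delete_def M_def p_def poly_monom)
  have "det (mat (Suc n) (Suc n) (\<lambda>(i, j). x i ^ j)) = det M"
    unfolding M_def
  proof (rule det_mat_monic_poly[symmetric])
    fix j assume "j < Suc n"
    then show "degree (p j) = j"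
      by (auto simp: p_def degree_monom_eq degree_prod_sum_eq)
    show "lead_coeff (p j) = 1"
      by (auto simp: p_def degree_monom_eq lead_coeff_prod)
  qed
  also have "\<dots> = (\<Sum>i<Suc n. M $$ (i, n) * cofactor M i n)"
    by (rule laplace_expansion_column) (simp_all add: M_def)
  also have "\<dots> = M $$ (n, n) * cofactor M n n"
    by (simp add: last_column_eq_0)
  finally show ?case
    by (simp add: last_column cofactor_def minor Suc.IH vandermonde_def mult.commute)
qed

lemma vandermonde_sum_permutations_monic:
  fixes x :: "nat \<Rightarrow> 'a::idom"
  assumes "\<And>j. j < n \<Longrightarrow> degree (p j) = j" "\<And>j. j < n \<Longrightarrow> lead_coeff (p j) = 1"
  shows "vandermonde n x =
    (\<Sum>\<sigma> | \<sigma> permutes {..<n}. of_int (sign \<sigma>) * (\<Prod>i<n. poly (p (\<sigma> i)) (x i)))"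
  using det_mat_monic_poly[OF assms]
  by (simp only: det_mat_power_eq_vandermonde det_mat_sum_permutations)

lemma vandermonde_sum_permutations:
  fixes x :: "nat \<Rightarrow> 'a::idom"
  shows "vandermonde n x = (\<Sum>\<sigma> | \<sigma> permutes {..<n}. of_int (sign \<sigma>) * (\<Prod>i<n. x i ^ \<sigma> i))"
  by (simp only: det_mat_power_eq_vandermonde[symmetric] det_mat_sum_permutations)

lemma vandermonde_permute:
  fixes x :: "nat \<Rightarrow> 'a::idom"
  assumes "\<tau> permutes {..<n}"
  shows "vandermonde n (\<lambda>i. x (\<tau> i)) = of_int (sign \<tau>) * vandermonde n x"
proof -
  define V where "V = mat n n (\<lambda>(i, j). x i ^ j)"
  have "\<tau> i < n" if "i < n" for i
    using permutes_in_image[OF assms, of i] that by simp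
  then have "mat n n (\<lambda>(i, j). x (\<tau> i) ^ j) = mat n n (\<lambda>(i, j). V $$ (\<tau> i, j))"
    by (intro eq_matI) (auto simp: V_def)
  then have "vandermonde n (\<lambda>i. x (\<tau> i)) = det (mat n n (\<lambda>(i, j). V $$ (\<tau> i, j)))"
    by (simp only: det_mat_power_eq_vandermonde[symmetric])
  also have "\<dots> = of_int (sign \<tau>) * det V"
    using assms by (intro det_permute_rows) (simp_all add: V_def atLeast0LessThan)
  finally show ?thesis
    by (simp only: V_def det_mat_power_eq_vandermonde)
qed

section \<open>Falling factorials\<close>

definition falling_factorial :: "nat \<Rightarrow> 'a::comm_ring_1 poly" where
  "falling_factorial m = (\<Prod>l<m. [:- of_nat l, 1:])"

lemma degree_falling_factorial: "degree (falling_factorial m :: 'a::idom poly) = m"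
  by (simp add: falling_factorial_def degree_prod_sum_eq)

lemma lead_coeff_falling_factorial: "lead_coeff (falling_factorial m :: 'a::idom poly) = 1"
  by (simp add: falling_factorial_def lead_coeff_prod)

lemma poly_falling_factorial_add:
  "poly (falling_factorial (i + j)) x =
     poly (falling_factorial i) x * poly (falling_factorial j) (x - of_nat i)"
  by (induction j) (simp_all add: falling_factorial_def poly_prod algebra_simps)

lemma poly_falling_factorial_Suc:
  "poly (falling_factorial (Suc m)) x = (x - of_nat m) * poly (falling_factorial m) x"
  by (simp add: falling_factorial_def poly_prod algebra_simps)

lemma poly_falling_factorial_of_nat:
  "poly (falling_factorial m) (of_nat d :: 'a::field_char_0) = fact m * of_nat (d choose m)"
  using gbinomial_mult_fact[of m "of_nat d :: 'a"]
  by (simp add: falling_factorial_def poly_prod binomial_gbinomial atLeast0LessThan)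

section \<open>Polynomial functions up to terms of lower degree\<close>

definition monomial :: "'i set \<Rightarrow> ('i \<Rightarrow> nat) \<Rightarrow> ('i \<Rightarrow> 'a::comm_monoid_mult) \<Rightarrow> 'a" where
  "monomial I e x = (\<Prod>i\<in>I. x i ^ e i)"

lemma monomial_0: "monomial I (\<lambda>_. 0) x = 1"
  by (simp add: monomial_def)

lemma monomial_add: "monomial I (\<lambda>i. e i + e' i) x = monomial I e x * monomial I e' x"
  by (simp add: monomial_def power_add prod.distrib)

lemma monomial_fun_upd_Suc:
  assumes "finite I" "i \<in> I"
  shows "monomial I (e(i := Suc (e i))) x = x i * monomial I e x"
  using assms by (simp add: monomial_def prod.remove[of I i] mult.assoc)

lemma sum_fun_upd_Suc:
  fixes e :: "'i \<Rightarrow> nat"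
  assumes "finite I" "i \<in> I"
  shows "sum (e(i := Suc (e i))) I = Suc (sum e I)"
  using assms by (simp add: sum.remove[of I i])

inductive_set polyfun_less :: "'i set \<Rightarrow> nat \<Rightarrow> (('i \<Rightarrow> 'a::comm_ring_1) \<Rightarrow> 'a) set"
  for I :: "'i set" and D :: nat where
  zero: "(\<lambda>_. 0) \<in> polyfun_less I D"
| monomial: "sum e I < D \<Longrightarrow> (\<lambda>x. c * monomial I e x) \<in> polyfun_less I D"
| add: "f \<in> polyfun_less I D \<Longrightarrow> g \<in> polyfun_less I D \<Longrightarrow> (\<lambda>x. f x + g x) \<in> polyfun_less I D"

lemma polyfun_less_mono:
  assumes "f \<in> polyfun_less I D" "D \<le> D'"
  shows "f \<in> polyfun_less I D'"
  using assms by induction (auto intro: polyfun_less.intros)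

lemma polyfun_less_const: "0 < D \<Longrightarrow> (\<lambda>_. c) \<in> polyfun_less I D"
  using polyfun_less.monomial[of "\<lambda>_. 0" I D c] by (simp add: monomial_0)

lemma polyfun_less_var:
  fixes I :: "'i set"
  assumes "finite I" "i \<in> I" "1 < D"
  shows "(\<lambda>x. x i) \<in> polyfun_less I D"
proof -
  define e :: "'i \<Rightarrow> nat" where "e = (\<lambda>_. 0)(i := Suc 0)"
  have sum_e: "sum e I = 1" and monomial_e: "monomial I e x = x i" for x
    using sum_fun_upd_Suc[OF assms(1,2), of "\<lambda>_. 0"] monomial_fun_upd_Suc[OF assms(1,2), of "\<lambda>_. 0"]
    by (auto simp: e_def monomial_0)
  have "(\<lambda>x. 1 * monomial I e x) \<in> polyfun_less I D"
    using assms(3) by (intro polyfun_less.monomial) (simp add: sum_e)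
  then show ?thesis
    by (simp only: monomial_e mult_1)
qed

lemma polyfun_less_mult:
  assumes "f \<in> polyfun_less I D" "g \<in> polyfun_less I (Suc D')"
  shows "(\<lambda>x. f x * g x) \<in> polyfun_less I (D + D')"
  using assms(1)
proof induction
  case zero
  show ?case by (simp add: polyfun_less.zero)
next
  case (monomial e c)
  show ?case
    using assms(2)
  proof induction
    case zero
    show ?case by (simp add: polyfun_less.zero)
  next
    case (monomial e' c')
    then have "sum (\<lambda>i. e i + e' i) I < D + D'"
      using \<open>sum e I < D\<close> by (simp add: sum.distrib)
    from polyfun_less.monomial[OF this, of "c * c'"] show ?case
      by (simp add: monomial_add mult_ac)
  next
    case (add f g)
    then show ?case by (simp add: distrib_left polyfun_less.add)
  qed
next
  case (add f f')
  then show ?case by (simp add: distrib_right polyfun_less.add)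
qed

lemma polyfun_less_cmult:
  assumes "f \<in> polyfun_less I D"
  shows "(\<lambda>x. c * f x) \<in> polyfun_less I D"
  using polyfun_less_mult[OF assms polyfun_less_const[of "Suc 0" c]] by (simp add: mult.commute)

lemma polyfun_less_diff:
  assumes "f \<in> polyfun_less I D" "g \<in> polyfun_less I D"
  shows "(\<lambda>x. f x - g x) \<in> polyfun_less I D"
  using polyfun_less.add[OF assms(1) polyfun_less_cmult[OF assms(2), of "-1"]] by simp

lemma polyfun_less_sum:
  "(\<And>t. t \<in> T \<Longrightarrow> f t \<in> polyfun_less I D) \<Longrightarrow> (\<lambda>x. \<Sum>t\<in>T. f t x) \<in> polyfun_less I D"
  by (induction T rule: infinite_finite_induct)
     (auto intro: polyfun_less.zero polyfun_less.add)

definition top_degree_eq ::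
  "'i set \<Rightarrow> nat \<Rightarrow> (('i \<Rightarrow> 'a::comm_ring_1) \<Rightarrow> 'a) \<Rightarrow> (('i \<Rightarrow> 'a) \<Rightarrow> 'a) \<Rightarrow> bool" where
  "top_degree_eq I D f g \<longleftrightarrow>
     g \<in> polyfun_less I (Suc D) \<and> (\<lambda>x. f x - g x) \<in> polyfun_less I D"

lemma top_degree_eq_imp_polyfun_less:
  assumes "top_degree_eq I D f g"
  shows "f \<in> polyfun_less I (Suc D)"
proof -
  have "(\<lambda>x. (f x - g x) + g x) \<in> polyfun_less I (Suc D)"
    using assms by (intro polyfun_less.add) (auto simp: top_degree_eq_def intro: polyfun_less_mono)
  then show ?thesis by simp
qed

lemma top_degree_eq_refl: "g \<in> polyfun_less I (Suc D) \<Longrightarrow> top_degree_eq I D g g"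
  by (simp add: top_degree_eq_def polyfun_less.zero)

lemma top_degree_eq_minus_const:
  "f \<in> polyfun_less I 2 \<Longrightarrow> top_degree_eq I 1 (\<lambda>x. f x - c) f"
  by (simp add: top_degree_eq_def numeral_2_eq_2 polyfun_less_const)

lemma top_degree_eq_mult:
  assumes "top_degree_eq I D f g" "top_degree_eq I D' f' g'"
  shows "top_degree_eq I (D + D') (\<lambda>x. f x * f' x) (\<lambda>x. g x * g' x)"
  unfolding top_degree_eq_def
proof
  show "(\<lambda>x. g x * g' x) \<in> polyfun_less I (Suc (D + D'))"
    using assms polyfun_less_mult[of g I "Suc D" g' D'] by (simp add: top_degree_eq_def)
  have "(\<lambda>x. (f x - g x) * f' x) \<in> polyfun_less I (D + D')"
    using assms(1) top_degree_eq_imp_polyfun_less[OF assms(2)]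
    by (intro polyfun_less_mult) (simp_all add: top_degree_eq_def)
  moreover have "(\<lambda>x. (f' x - g' x) * g x) \<in> polyfun_less I (D + D')"
    unfolding add.commute[of D] using assms
    by (intro polyfun_less_mult) (simp_all add: top_degree_eq_def)
  ultimately have "(\<lambda>x. (f x - g x) * f' x + (f' x - g' x) * g x) \<in> polyfun_less I (D + D')"
    by (rule polyfun_less.add)
  then show "(\<lambda>x. f x * f' x - g x * g' x) \<in> polyfun_less I (D + D')"
    by (simp add: algebra_simps)
qed

lemma top_degree_eq_prod:
  assumes "\<And>t. t \<in> T \<Longrightarrow> top_degree_eq I (D t) (f t) (g t)"
  shows "top_degree_eq I (\<Sum>t\<in>T. D t) (\<lambda>x. \<Prod>t\<in>T. f t x) (\<lambda>x. \<Prod>t\<in>T. g t x)"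
  using assms
  by (induction T rule: infinite_finite_induct)
     (simp_all add: top_degree_eq_mult top_degree_eq_refl polyfun_less_const)

section \<open>The coefficient formula on a grid\<close>

definition lagrange_weight :: "'a::field set \<Rightarrow> 'a \<Rightarrow> 'a" where
  "lagrange_weight S a = 1 / (\<Prod>b\<in>S - {a}. a - b)"

lemma sum_lagrange_weight:
  fixes p :: "'a::field poly"
  assumes S: "card S = Suc d" and p: "degree p \<le> d"
  shows "(\<Sum>a\<in>S. lagrange_weight S a * poly p a) = coeff p d"
proof -
  have finite: "finite S"
    using S by (simp add: card_ge_0_finite)
  define l where "l a = (\<Prod>b\<in>S - {a}. [:- b, 1:])" for a
  have degree_l: "degree (l a) = d" if "a \<in> S" for a
    using that S by (simp add: l_def degree_prod_sum_eq finite)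
  have coeff_l: "coeff (l a) d = 1" if "a \<in> S" for a
    using lead_coeff_prod[of "\<lambda>b. [:- b, 1:]" "S - {a}"] degree_l[OF that] by (simp add: l_def)
  have poly_l: "lagrange_weight S a * poly (l a) x = of_bool (a = x)" if "a \<in> S" "x \<in> S" for a x
    using that finite by (auto simp: l_def poly_prod lagrange_weight_def)
  define q where "q = (\<Sum>a\<in>S. smult (lagrange_weight S a * poly p a) (l a))"
  have "p = q"
  proof (rule poly_eqI_degree[of S])
    fix x assume x: "x \<in> S"
    have "poly q x = (\<Sum>a\<in>S. poly p a * (lagrange_weight S a * poly (l a) x))"
      by (simp add: q_def poly_sum mult_ac)
    also have "\<dots> = (\<Sum>a\<in>S. if a = x then poly p x else 0)"
      by (intro sum.cong) (auto simp: poly_l x)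
    finally show "poly p x = poly q x"
      using x finite by simp
  next
    have "degree q \<le> d"
      unfolding q_def by (intro degree_sum_le finite order_trans[OF degree_smult_le]) (simp add: degree_l)
    then show "degree q < card S" "degree p < card S"
      using S p by simp_all
  qed
  then have "coeff p d = coeff q d"
    by simp
  also have "\<dots> = (\<Sum>a\<in>S. lagrange_weight S a * poly p a)"
    by (simp add: q_def coeff_sum coeff_l)
  finally show ?thesis ..
qed

text \<open>
  On polynomial functions of degree at most \<open>\<Sum>\<^sub>i (card (A i) - 1)\<close>, the following functional is the
  coefficient of \<open>\<Prod>\<^sub>i x\<^sub>i\<^bsup>card (A i) - 1\<^esup>\<close>.
\<close>

definition top_coeff :: "'i set \<Rightarrow> ('i \<Rightarrow> 'a::field set) \<Rightarrow> (('i \<Rightarrow> 'a) \<Rightarrow> 'a) \<Rightarrow> 'a" where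
  "top_coeff I A f = (\<Sum>a\<in>PiE I A. (\<Prod>i\<in>I. lagrange_weight (A i) (a i)) * f a)"

lemma top_coeff_eq_0: "(\<And>a. a \<in> PiE I A \<Longrightarrow> f a = 0) \<Longrightarrow> top_coeff I A f = 0"
  by (simp add: top_coeff_def)

lemma top_coeff_add: "top_coeff I A (\<lambda>a. f a + g a) = top_coeff I A f + top_coeff I A g"
  by (simp add: top_coeff_def distrib_left sum.distrib)

lemma top_coeff_cmult: "top_coeff I A (\<lambda>a. c * f a) = c * top_coeff I A f"
  by (simp add: top_coeff_def sum_distrib_left mult.left_commute)

lemma top_coeff_sum: "top_coeff I A (\<lambda>a. \<Sum>x\<in>X. f x a) = (\<Sum>x\<in>X. top_coeff I A (f x))"
  by (simp add: top_coeff_def sum_distrib_left) (rule sum.swap)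

lemma finite_sumset:
  assumes "finite I" "\<And>i. i \<in> I \<Longrightarrow> finite (A i)"
  shows "finite {(\<Sum>i\<in>I. a i) | a. (\<forall>i\<in>I. a i \<in> A i) \<and> P a}" (is "finite ?S")
proof (rule finite_subset)
  show "?S \<subseteq> (\<lambda>a. \<Sum>i\<in>I. a i) ` PiE I A"
  proof
    fix s assume "s \<in> ?S"
    then obtain a where "s = (\<Sum>i\<in>I. a i)" "\<forall>i\<in>I. a i \<in> A i" by blast
    then show "s \<in> (\<lambda>a. \<Sum>i\<in>I. a i) ` PiE I A"
      by (intro image_eqI[of _ _ "restrict a I"]) auto
  qed
  show "finite ((\<lambda>a. \<Sum>i\<in>I. a i) ` PiE I A)"
    using assms by (intro finite_imageI finite_PiE)
qed

locale grid =
  fixes I :: "'i set" and A :: "'i \<Rightarrow> 'a::field set" and d :: "'i \<Rightarrow> nat"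
  assumes finite_index: "finite I"
    and card_grid: "i \<in> I \<Longrightarrow> card (A i) = Suc (d i)"
begin

lemma finite_grid: "i \<in> I \<Longrightarrow> finite (A i)"
  by (simp add: card_grid card_ge_0_finite)

lemma top_coeff_monomial:
  assumes "sum e I \<le> sum d I"
  shows "top_coeff I A (monomial I e) = of_bool (\<forall>i\<in>I. e i = d i)"
proof -
  have factor: "(\<Sum>x\<in>A i. lagrange_weight (A i) x * x ^ e i) = of_bool (e i = d i)"
    if "i \<in> I" "e i \<le> d i" for i
    using sum_lagrange_weight[of "A i" "d i" "monom 1 (e i)"] that
    by (simp add: card_grid degree_monom_eq poly_monom)
  have "top_coeff I A (monomial I e) = (\<Prod>i\<in>I. \<Sum>x\<in>A i. lagrange_weight (A i) x * x ^ e i)"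
    by (subst prod_sum_PiE)
       (simp_all add: top_coeff_def monomial_def finite_index finite_grid prod.distrib)
  also have "\<dots> = of_bool (\<forall>i\<in>I. e i = d i)"
  proof (cases "\<exists>i\<in>I. e i < d i")
    case True
    then show ?thesis
      using factor finite_index by (subst prod_zero) (auto intro!: bexI)
  next
    case False
    then have "d i \<le> e i" if "i \<in> I" for i
      using that by (simp add: not_less)
    moreover from this have "sum d I = sum e I"
      using assms by (intro antisym) (simp_all add: sum_mono)
    ultimately have "e i = d i" if "i \<in> I" for i
      using sum_mono_inv[of d I e i] that finite_index by simp
    then show ?thesis
      using factor by simp
  qed
  finally show ?thesis .
qed

lemma top_coeff_polyfun_less:
  assumes "f \<in> polyfun_less I (sum d I)"
  shows "top_coeff I A f = 0"
  using assms
proof induction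
  case (monomial e c)
  then have "\<not> (\<forall>i\<in>I. e i = d i)"
    using sum.cong[of I I e d] by (metis less_irrefl)
  then show ?case
    using monomial by (simp add: top_coeff_cmult top_coeff_monomial)
qed (simp_all add: top_coeff_add top_coeff_eq_0)

theorem combinatorial_nullstellensatz:
  assumes "top_degree_eq I (sum d I) f g" "top_coeff I A g \<noteq> 0"
  obtains a where "a \<in> PiE I A" "f a \<noteq> 0"
proof (rule ccontr)
  assume "\<not> thesis"
  then have "top_coeff I A f = 0"
    using that by (intro top_coeff_eq_0) blast
  moreover have "top_coeff I A f = top_coeff I A (\<lambda>a. f a - g a) + top_coeff I A g"
    by (subst top_coeff_add[symmetric]) simp
  moreover have "top_coeff I A (\<lambda>a. f a - g a) = 0"
    using assms(1) by (intro top_coeff_polyfun_less) (simp add: top_degree_eq_def)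
  ultimately show False
    using assms(2) by simp
qed

theorem card_nonvanishing_sumset:
  assumes f: "top_degree_eq I D f g" and degree: "D + N = sum d I"
    and nonzero: "top_coeff I A (\<lambda>a. g a * (\<Sum>i\<in>I. a i) ^ N) \<noteq> 0"
  shows "N < card {(\<Sum>i\<in>I. a i) | a. (\<forall>i\<in>I. a i \<in> A i) \<and> f a \<noteq> 0}" (is "N < card ?S")
proof (rule ccontr)
  assume "\<not> N < card ?S"
  then obtain r where N: "N = card ?S + r"
    using le_Suc_ex by (auto simp: not_less)
  define s :: "('i \<Rightarrow> 'a) \<Rightarrow> 'a" where "s a = (\<Sum>i\<in>I. a i)" for a
  have s: "s \<in> polyfun_less I 2"
    unfolding s_def by (intro polyfun_less_sum polyfun_less_var finite_index) auto
  have "top_degree_eq I (D + ((\<Sum>_\<in>?S. 1) + (\<Sum>_<r. 1)))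
      (\<lambda>a. f a * ((\<Prod>v\<in>?S. s a - v) * (\<Prod>_<r. s a - 0)))
      (\<lambda>a. g a * ((\<Prod>v\<in>?S. s a) * (\<Prod>_<r. s a)))"
    by (intro top_degree_eq_mult top_degree_eq_prod top_degree_eq_minus_const f s)
  then have "top_degree_eq I (sum d I)
      (\<lambda>a. f a * ((\<Prod>v\<in>?S. s a - v) * s a ^ r)) (\<lambda>a. g a * s a ^ N)"
    by (simp add: degree[symmetric] N power_add)
  then obtain a where a: "a \<in> PiE I A" "f a * ((\<Prod>v\<in>?S. s a - v) * s a ^ r) \<noteq> 0"
    using combinatorial_nullstellensatz nonzero unfolding s_def by blast
  have "finite ?S"
    by (intro finite_sumset finite_index finite_grid)
  moreover have "s a \<in> ?S"
    using a by (auto simp: s_def)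
  ultimately show False
    using a(2) by simp
qed

end

locale grid_char_0 = grid I A d
  for I :: "'i set" and A :: "'i \<Rightarrow> 'a::field_char_0 set" and d
begin

lemma top_coeff_monomial_falling_factorial:
  assumes "sum e I = sum d I"
  shows "top_coeff I A (monomial I e) =
    (\<Prod>i\<in>I. poly (falling_factorial (e i)) (of_nat (d i)) / fact (d i))"
proof (cases "\<forall>i\<in>I. e i = d i")
  case True
  then show ?thesis
    using assms by (simp add: top_coeff_monomial poly_falling_factorial_of_nat)
next
  case False
  have "\<exists>i\<in>I. d i < e i"
  proof (rule ccontr)
    assume "\<not> ?thesis"
    then have "e i = d i" if "i \<in> I" for i
      using sum_mono_inv[of e I d i] that assms finite_index by (auto simp: not_less)
    with False show False by blast
  qed
  then have "(\<Prod>i\<in>I. poly (falling_factorial (e i)) (of_nat (d i) :: 'a) / fact (d i)) = 0"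
    using finite_index by (intro prod_zero) (auto simp: poly_falling_factorial_of_nat)
  then show ?thesis
    using assms False by (simp add: top_coeff_monomial)
qed

lemma top_coeff_monomial_power_sum:
  assumes "sum e I + N = sum d I"
  shows "top_coeff I A (\<lambda>a. monomial I e a * (\<Sum>i\<in>I. a i) ^ N) =
    fact N * (\<Prod>i\<in>I. poly (falling_factorial (e i)) (of_nat (d i)) / fact (d i))"
  using assms
proof (induction N arbitrary: e)
  case 0
  then show ?case by (simp add: top_coeff_monomial_falling_factorial)
next
  case (Suc N)
  define r :: "('i \<Rightarrow> nat) \<Rightarrow> 'a" where
    "r e = (\<Prod>i\<in>I. poly (falling_factorial (e i)) (of_nat (d i)) / fact (d i))" for e
  have r_step: "r (e(i := Suc (e i))) = (of_nat (d i) - of_nat (e i)) * r e" if "i \<in> I" for i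
    using that finite_index
    by (simp add: r_def prod.remove[of I i] poly_falling_factorial_Suc mult.assoc)
  have "(\<Sum>i\<in>I. of_nat (d i) - of_nat (e i) :: 'a) = of_nat (sum d I) - of_nat (sum e I)"
    by (simp add: sum_subtractf)
  also have "\<dots> = of_nat (Suc N)"
    unfolding Suc.prems[symmetric] by simp
  finally have total: "(\<Sum>i\<in>I. of_nat (d i) - of_nat (e i) :: 'a) = of_nat (Suc N)" .
  have "top_coeff I A (\<lambda>a. monomial I e a * (\<Sum>i\<in>I. a i) ^ Suc N) =
      top_coeff I A (\<lambda>a. \<Sum>i\<in>I. monomial I (e(i := Suc (e i))) a * (\<Sum>i\<in>I. a i) ^ N)"
    by (simp add: monomial_fun_upd_Suc finite_index sum_distrib_left sum_distrib_right mult_ac)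
  also have "\<dots> = (\<Sum>i\<in>I. fact N * r (e(i := Suc (e i))))"
    unfolding top_coeff_sum r_def
    by (intro sum.cong refl Suc.IH, subst sum_fun_upd_Suc[OF finite_index])
       (use Suc.prems in simp_all)
  also have "\<dots> = (\<Sum>i\<in>I. of_nat (d i) - of_nat (e i)) * (fact N * r e)"
    by (simp add: r_step sum_distrib_left sum_distrib_right mult.left_commute)
  also have "\<dots> = fact (Suc N) * r e"
    unfolding total by (simp add: mult.assoc)
  finally show ?case by (simp add: r_def)
qed

end
section \<open>Vandermonde products as leading forms\<close>

lemma top_coeff_monomial_vandermonde_power_sum:
  fixes A :: "nat \<Rightarrow> 'a::field_char_0 set"
  assumes "grid {..<n} A d" and degree: "(\<Sum>i<n. e i) + (\<Sum>i<n. i) + N = (\<Sum>i<n. d i)"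
  shows "top_coeff {..<n} A (\<lambda>a. monomial {..<n} e a * vandermonde n a * (\<Sum>i<n. a i) ^ N) =
    fact N * (\<Prod>i<n. poly (falling_factorial (e i)) (of_nat (d i)) / fact (d i)) *
    vandermonde n (\<lambda>i. of_nat (d i) - of_nat (e i))"
proof -
  interpret grid_char_0 "{..<n}" A d
    using assms(1) by (simp add: grid_char_0_def)
  let ?P = "{\<sigma>. \<sigma> permutes {..<n}}"
  let ?r = "\<Prod>i<n. poly (falling_factorial (e i)) (of_nat (d i)) / fact (d i) :: 'a"
  let ?s = "\<lambda>\<sigma> i. poly (falling_factorial (\<sigma> i)) (of_nat (d i) - of_nat (e i)) :: 'a"
  have summand: "top_coeff {..<n} A (\<lambda>a. monomial {..<n} (\<lambda>i. e i + \<sigma> i) a * (\<Sum>i<n. a i) ^ N) =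
      fact N * ?r * (\<Prod>i<n. ?s \<sigma> i)" if "\<sigma> \<in> ?P" for \<sigma>
  proof -
    have "(\<Sum>i<n. \<sigma> i) = (\<Sum>i<n. i)"
      using sum.permute[of \<sigma> "{..<n}" "\<lambda>i. i"] that by simp
    then have "(\<Sum>i<n. e i + \<sigma> i) + N = (\<Sum>i<n. d i)"
      using degree by (simp add: sum.distrib)
    then show ?thesis
      by (simp add: top_coeff_monomial_power_sum poly_falling_factorial_add prod.distrib
                    prod_dividef)
  qed
  have "top_coeff {..<n} A (\<lambda>a. monomial {..<n} e a * vandermonde n a * (\<Sum>i<n. a i) ^ N) =
      top_coeff {..<n} A (\<lambda>a. \<Sum>\<sigma>\<in>?P. of_int (sign \<sigma>) *
        (monomial {..<n} (\<lambda>i. e i + \<sigma> i) a * (\<Sum>i<n. a i) ^ N))"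
    by (simp add: vandermonde_sum_permutations monomial_add monomial_def[of _ "_ :: nat \<Rightarrow> nat"]
                  sum_distrib_left sum_distrib_right mult_ac)
  also have "\<dots> = (\<Sum>\<sigma>\<in>?P. of_int (sign \<sigma>) * (fact N * ?r * (\<Prod>i<n. ?s \<sigma> i)))"
    unfolding top_coeff_sum top_coeff_cmult by (intro sum.cong refl) (simp only: summand)
  also have "\<dots> = fact N * ?r * (\<Sum>\<sigma>\<in>?P. of_int (sign \<sigma>) * (\<Prod>i<n. ?s \<sigma> i))"
    by (simp add: sum_distrib_left mult.left_commute)
  also have "(\<Sum>\<sigma>\<in>?P. of_int (sign \<sigma>) * (\<Prod>i<n. ?s \<sigma> i)) =
      vandermonde n (\<lambda>i. of_nat (d i) - of_nat (e i))"
    by (rule vandermonde_sum_permutations_monic[symmetric])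
       (rule degree_falling_factorial lead_coeff_falling_factorial)+
  finally show ?thesis .
qed

definition permanent :: "nat \<Rightarrow> (nat \<Rightarrow> nat \<Rightarrow> 'a::comm_semiring_1) \<Rightarrow> 'a" where
  "permanent n f = (\<Sum>\<sigma> | \<sigma> permutes {..<n}. \<Prod>i<n. f i (\<sigma> i))"

lemma permanent_pos:
  fixes f :: "nat \<Rightarrow> nat \<Rightarrow> 'a::linordered_semidom"
  assumes "\<And>i j. i < n \<Longrightarrow> j < n \<Longrightarrow> 0 < f i j"
  shows "0 < permanent n f"
  unfolding permanent_def
proof (intro sum_pos prod_pos ballI)
  show "0 < f i (\<sigma> i)" if "\<sigma> \<in> {\<sigma>. \<sigma> permutes {..<n}}" "i \<in> {..<n}" for \<sigma> i
    using that assms permutes_in_image[of \<sigma> "{..<n}" i] by simp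
qed (auto simp: finite_permutations intro: permutes_id)

lemma top_coeff_scaled_vandermonde_power_sum:
  fixes A :: "nat \<Rightarrow> 'a::field_char_0 set"
  assumes "grid {..<n} A (\<lambda>_. d)" and degree: "(\<Sum>i<n. i) + (\<Sum>i<n. i) + N = n * d"
  shows "top_coeff {..<n} A
      (\<lambda>a. vandermonde n (\<lambda>i. \<alpha> i * a i) * vandermonde n a * (\<Sum>i<n. a i) ^ N) =
    fact N * (\<Prod>i<n. poly (falling_factorial i) (of_nat d) / fact d) *
    vandermonde n (\<lambda>i. of_nat d - of_nat i) * permanent n (\<lambda>i j. \<alpha> i ^ j)"
proof -
  let ?P = "{\<tau>. \<tau> permutes {..<n}}"
  let ?K = "fact N * (\<Prod>i<n. poly (falling_factorial i) (of_nat d) / fact d) *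
    vandermonde n (\<lambda>i. of_nat d - of_nat i) :: 'a"
  have summand: "top_coeff {..<n} A
      (\<lambda>a. monomial {..<n} \<tau> a * vandermonde n a * (\<Sum>i<n. a i) ^ N) = of_int (sign \<tau>) * ?K"
    if "\<tau> permutes {..<n}" for \<tau>
  proof -
    have "(\<Sum>i<n. \<tau> i) = (\<Sum>i<n. i)"
      using sum.permute[OF that, of "\<lambda>i. i"] by simp
    moreover have "(\<Prod>i<n. poly (falling_factorial (\<tau> i)) (of_nat d) / fact d :: 'a) =
        (\<Prod>i<n. poly (falling_factorial i) (of_nat d) / fact d)"
      using prod.permute[OF that, of "\<lambda>i. poly (falling_factorial i) (of_nat d) / fact d :: 'a"]
      by (simp add: o_def)
    moreover have "vandermonde n (\<lambda>i. of_nat d - of_nat (\<tau> i) :: 'a) =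
        of_int (sign \<tau>) * vandermonde n (\<lambda>i. of_nat d - of_nat i)"
      using that by (rule vandermonde_permute)
    ultimately show ?thesis
      using top_coeff_monomial_vandermonde_power_sum[OF assms(1), of \<tau> N] degree by simp
  qed
  have "top_coeff {..<n} A
      (\<lambda>a. vandermonde n (\<lambda>i. \<alpha> i * a i) * vandermonde n a * (\<Sum>i<n. a i) ^ N) =
    top_coeff {..<n} A (\<lambda>a. \<Sum>\<tau>\<in>?P. of_int (sign \<tau>) * (\<Prod>i<n. \<alpha> i ^ \<tau> i) *
      (monomial {..<n} \<tau> a * vandermonde n a * (\<Sum>i<n. a i) ^ N))"
    by (simp add: vandermonde_sum_permutations[of n "\<lambda>i. \<alpha> i * _ i"] monomial_def
                  power_mult_distrib prod.distrib sum_distrib_right mult.assoc)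
  also have "\<dots> = (\<Sum>\<tau>\<in>?P. of_int (sign \<tau>) * (\<Prod>i<n. \<alpha> i ^ \<tau> i) * (of_int (sign \<tau>) * ?K))"
    unfolding top_coeff_sum top_coeff_cmult
    by (intro sum.cong refl) (simp only: summand mem_Collect_eq)
  also have "\<dots> = (\<Sum>\<tau>\<in>?P. ?K * (\<Prod>i<n. \<alpha> i ^ \<tau> i))"
    by (intro sum.cong) (auto simp: sign_def)
  finally show ?thesis
    by (simp only: permanent_def sum_distrib_left)
qed

lemma top_degree_eq_scaled_vandermonde:
  "top_degree_eq {..<n} (\<Sum>j<n. j)
     (\<lambda>x. \<Prod>j<n. \<Prod>i<j. \<alpha> j * x j - \<alpha> i * x i - c i j) (\<lambda>x. vandermonde n (\<lambda>i. \<alpha> i * x i))"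
proof -
  have "(\<lambda>x. \<alpha> j * x j - \<alpha> i * x i) \<in> polyfun_less {..<n} 2" if "j < n" "i < j" for i j
    using that by (intro polyfun_less_diff polyfun_less_cmult polyfun_less_var) auto
  then have "top_degree_eq {..<n} (\<Sum>j<n. \<Sum>i<j. 1)
     (\<lambda>x. \<Prod>j<n. \<Prod>i<j. \<alpha> j * x j - \<alpha> i * x i - c i j)
     (\<lambda>x. \<Prod>j<n. \<Prod>i<j. \<alpha> j * x j - \<alpha> i * x i)"
    by (intro top_degree_eq_prod top_degree_eq_minus_const) auto
  then show ?thesis
    by (simp add: vandermonde_def)
qed

section \<open>Restricted sumsets\<close>

lemma twice_sum_lessThan_plus_mult:
  fixes n d :: nat
  assumes "n \<le> Suc d"
  shows "(\<Sum>j<n. j) + (\<Sum>j<n. j) + (Suc d - n) * n = n * d"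
proof -
  obtain t where t: "Suc d = n + t"
    using assms le_Suc_ex by blast
  have "(\<Sum>j<n. j) + (\<Sum>j<n. j) = n * (n - 1)"
    by (induction n) (auto simp: algebra_simps)
  then show ?thesis
    using t by (cases n) (auto simp: algebra_simps)
qed

theorem card_restricted_sumset:
  fixes A :: "nat \<Rightarrow> 'a::field_char_0 set" and \<alpha> :: "nat \<Rightarrow> 'a" and b c :: "nat \<Rightarrow> nat \<Rightarrow> 'a"
  assumes "0 < k" "n \<le> k"
    and permanent: "permanent n (\<lambda>i j. \<alpha> i ^ j) \<noteq> 0"
    and A: "\<And>i. i < n \<Longrightarrow> card (A i) = k"
  shows "(k - n) * n < card {(\<Sum>i<n. a i) | a. (\<forall>i<n. a i \<in> A i) \<and>
    (\<forall>j<n. \<forall>i<j. \<alpha> j * a j - \<alpha> i * a i \<noteq> b i j \<and> a j - a i \<noteq> c i j)}"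
proof -
  let ?N = "(k - n) * n"
  obtain d where k: "k = Suc d"
    using \<open>0 < k\<close> gr0_implies_Suc by blast
  interpret grid "{..<n}" A "\<lambda>_. d"
    using A by unfold_locales (simp_all add: k)
  define f :: "(nat \<Rightarrow> 'a) \<Rightarrow> 'a" where
    "f x = (\<Prod>j<n. \<Prod>i<j. \<alpha> j * x j - \<alpha> i * x i - b i j) *
      (\<Prod>j<n. \<Prod>i<j. 1 * x j - 1 * x i - c i j)" for x
  have f: "top_degree_eq {..<n} ((\<Sum>j<n. j) + (\<Sum>j<n. j)) f
      (\<lambda>x. vandermonde n (\<lambda>i. \<alpha> i * x i) * vandermonde n (\<lambda>i. 1 * x i))"
    unfolding f_def by (intro top_degree_eq_mult top_degree_eq_scaled_vandermonde)
  have degree: "(\<Sum>j<n. j) + (\<Sum>j<n. j) + ?N = n * d"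
    using \<open>n \<le> k\<close> unfolding k by (rule twice_sum_lessThan_plus_mult)
  have "vandermonde n (\<lambda>i. of_nat d - of_nat i :: 'a) \<noteq> 0"
    by (simp add: vandermonde_eq_0_iff)
  moreover have "poly (falling_factorial i) (of_nat d :: 'a) \<noteq> 0" if "i < n" for i
    using that \<open>n \<le> k\<close> by (simp add: poly_falling_factorial_of_nat k)
  ultimately have "top_coeff {..<n} A
      (\<lambda>a. vandermonde n (\<lambda>i. \<alpha> i * a i) * vandermonde n a * (\<Sum>i<n. a i) ^ ?N) \<noteq> 0"
    using permanent by (simp add: top_coeff_scaled_vandermonde_power_sum[OF grid_axioms degree])
  then have "?N < card {(\<Sum>i<n. a i) | a. (\<forall>i\<in>{..<n}. a i \<in> A i) \<and> f a \<noteq> 0}"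
    using f degree by (intro card_nonvanishing_sumset) simp_all
  moreover have "f a \<noteq> 0 \<longleftrightarrow>
      (\<forall>j<n. \<forall>i<j. \<alpha> j * a j - \<alpha> i * a i \<noteq> b i j \<and> a j - a i \<noteq> c i j)" for a
    by (auto simp: f_def)
  ultimately show ?thesis
    by (simp add: Ball_def)
qed

corollary card_restricted_sumset_int:
  fixes A :: "nat \<Rightarrow> int set" and \<alpha> :: "nat \<Rightarrow> 'a::linordered_field" and c :: "nat \<Rightarrow> nat \<Rightarrow> int"
  assumes "0 < k" "n \<le> k"
    and \<alpha>: "\<And>i. i \<in> {1..n} \<Longrightarrow> 0 < \<alpha> i"
    and A: "\<And>i. i \<in> {1..n} \<Longrightarrow> card (A i) = k"
  shows "(k - n) * n < card {(\<Sum>i=1..n. a i) | a. (\<forall>i\<in>{1..n}. a i \<in> A i) \<and>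
    (\<forall>i\<in>{1..n}. \<forall>j\<in>{1..n}. i < j \<longrightarrow>
       of_int (a i) * \<alpha> i \<noteq> of_int (a j) * \<alpha> j \<and> a j - a i \<noteq> c i j)}"
    (is "_ < card ?T")
proof -
  let ?S = "{(\<Sum>i<n. a i) | a. (\<forall>i<n. a i \<in> of_int ` A (Suc i)) \<and> (\<forall>j<n. \<forall>i<j.
    \<alpha> (Suc j) * a j - \<alpha> (Suc i) * a i \<noteq> 0 \<and> a j - a i \<noteq> of_int (c (Suc i) (Suc j)))}"
  have "?S \<subseteq> of_int ` ?T"
  proof
    fix s assume "s \<in> ?S"
    then obtain a where s: "s = (\<Sum>i<n. a i)" and mem: "\<forall>i<n. a i \<in> of_int ` A (Suc i)"
      and a: "\<And>i j. j < n \<Longrightarrow> i < j \<Longrightarrow> \<alpha> (Suc j) * a j - \<alpha> (Suc i) * a i \<noteq> 0 \<and>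
        a j - a i \<noteq> of_int (c (Suc i) (Suc j))"
      by blast
    from mem obtain z where z: "\<And>i. i < n \<Longrightarrow> z i \<in> A (Suc i) \<and> a i = of_int (z i)"
      unfolding image_iff by metis
    define x where "x i = z (i - 1)" for i
    have "s = of_int (\<Sum>i=1..n. x i)"
      by (simp add: s z x_def sum.atLeast1_atMost_eq)
    moreover have "\<forall>i\<in>{1..n}. x i \<in> A i"
      unfolding image_Suc_lessThan[symmetric] by (simp add: x_def z)
    moreover have "of_int (z i) * \<alpha> (Suc i) \<noteq> of_int (z j) * \<alpha> (Suc j) \<and>
        z j - z i \<noteq> c (Suc i) (Suc j)" if "j < n" "i < j" for i j
      using a[OF that] z[of i] z[of j] that by (auto simp: mult.commute simp flip: of_int_diff)
    then have "\<forall>i\<in>{1..n}. \<forall>j\<in>{1..n}. i < j \<longrightarrow>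
        of_int (x i) * \<alpha> i \<noteq> of_int (x j) * \<alpha> j \<and> x j - x i \<noteq> c i j"
      unfolding image_Suc_lessThan[symmetric] by (simp add: x_def)
    ultimately show "s \<in> of_int ` ?T"
      by blast
  qed
  moreover have "finite ?T"
    using A \<open>0 < k\<close> by (intro finite_sumset) (simp_all add: card_ge_0_finite)
  ultimately have "card ?S \<le> card ?T"
    by (intro surj_card_le)
  moreover have "permanent n (\<lambda>i j. \<alpha> (Suc i) ^ j) \<noteq> 0"
    using \<alpha> by (intro less_imp_neq[THEN not_sym] permanent_pos) simp
  then have "(k - n) * n < card ?S"
    using assms by (intro card_restricted_sumset) (simp_all add: card_image inj_on_def)
  ultimately show ?thesis
    by linarith
qed

lemma cong_shift_imp_diff_unique:
  fixes X Y :: "int set"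
  assumes "finite X" "finite Y"
    and m: "m > 2 * Max {\<bar>x - y\<bar> | x y. x \<in> X \<and> y \<in> Y}"
  shows "\<exists>c. \<forall>x\<in>X. \<forall>y\<in>Y. [x + s = y + t] (mod m) \<longrightarrow> y - x = c"
proof -
  let ?D = "{\<bar>x - y\<bar> | x y. x \<in> X \<and> y \<in> Y}"
  have "?D = (\<lambda>(x, y). \<bar>x - y\<bar>) ` (X \<times> Y)"
    by auto
  then have "finite ?D"
    using assms by simp
  then have bound: "2 * \<bar>x - y\<bar> < m" if "x \<in> X" "y \<in> Y" for x y
    using Max_ge[of ?D "\<bar>x - y\<bar>"] m that by fastforce
  have "y - x = y' - x'"
    if "x \<in> X" "y \<in> Y" "x' \<in> X" "y' \<in> Y" "[x + s = y + t] (mod m)" "[x' + s = y' + t] (mod m)"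
    for x y x' y'
  proof -
    have "m dvd (x + s - (y + t)) - (x' + s - (y' + t))"
      using that(5,6) unfolding cong_iff_dvd_diff by (rule dvd_diff)
    then have "m dvd (x - y) - (x' - y')"
      by (simp add: algebra_simps)
    moreover have "\<bar>(x - y) - (x' - y')\<bar> \<le> \<bar>x - y\<bar> + \<bar>x' - y'\<bar>"
      by (rule abs_triangle_ineq4)
    then have "\<bar>(x - y) - (x' - y')\<bar> < m"
      using bound[OF that(1,2)] bound[OF that(3,4)] by simp
    ultimately show ?thesis
      using dvd_imp_le_int[of "(x - y) - (x' - y')" m] by linarith
  qed
  then show ?thesis by meson
qed

theorem theorem1p3:
  fixes n k :: nat
    and \<alpha> :: "nat \<Rightarrow> real"
    and b :: "nat \<Rightarrow> int"
    and A :: "nat \<Rightarrow> int set"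
    and m :: "nat \<Rightarrow> nat \<Rightarrow> int"
  assumes "n \<ge> 1" and "k \<ge> 1"
    and "\<forall>i\<in>{1..n}. \<alpha> i > 0"
    and "\<forall>i\<in>{1..n}. finite (A i) \<and> card (A i) = k"
    and "\<forall>i\<in>{1..n}. \<forall>j\<in>{1..n}. i < j \<longrightarrow>
           m i j > 2 * Max {\<bar>x - y\<bar> | x y. x \<in> A i \<and> y \<in> A j}"
  shows "int (card {(\<Sum>i=1..n. a i) | a :: nat \<Rightarrow> int.
            (\<forall>i\<in>{1..n}. a i \<in> A i) \<and>
            (\<forall>i\<in>{1..n}. \<forall>j\<in>{1..n}. i < j \<longrightarrow>
               of_int (a i) * \<alpha> i \<noteq> of_int (a j) * \<alpha> j \<and>
               \<not> [a i + b i = a j + b j] (mod m i j))})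
         > (int k - int n) * int n"
    (is "int (card ?T) > _")
proof (cases "n \<le> k")
  case False
  then have "(int k - int n) * int n < 0"
    using \<open>n \<ge> 1\<close> by (simp add: mult_neg_pos)
  then show ?thesis by linarith
next
  case True
  have "\<exists>c. \<forall>x\<in>A i. \<forall>y\<in>A j. [x + b i = y + b j] (mod m i j) \<longrightarrow> y - x = c"
    if "i \<in> {1..n}" "j \<in> {1..n}" "i < j" for i j
    using assms that by (intro cong_shift_imp_diff_unique) auto
  then obtain c where c: "\<And>i j x y. \<lbrakk>i \<in> {1..n}; j \<in> {1..n}; i < j; x \<in> A i; y \<in> A j;
      [x + b i = y + b j] (mod m i j)\<rbrakk> \<Longrightarrow> y - x = c i j"
    by metis
  have "(k - n) * n < card {(\<Sum>i=1..n. a i) | a. (\<forall>i\<in>{1..n}. a i \<in> A i) \<and>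
      (\<forall>i\<in>{1..n}. \<forall>j\<in>{1..n}. i < j \<longrightarrow>
         of_int (a i) * \<alpha> i \<noteq> of_int (a j) * \<alpha> j \<and> a j - a i \<noteq> c i j)}"
    using assms True by (intro card_restricted_sumset_int) auto
  also have "\<dots> \<le> card ?T"
    using assms(4) c by (intro card_mono finite_sumset) blast+
  finally show ?thesis
    using True by (simp flip: of_nat_diff of_nat_mult)
qed

end
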